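(* For $n \geq 1$ let $\rho_n = \min\{\frac{1}{4}, \frac{1}{2^{2^{n-2}}}\}$, let $D(n,\rho_n) \subset \mathbb{C}$ be the set defined in the context, and let $$S := \mathbb{C} \setminus \bigcup_{n \geq 1} D(n,\rho_n).$$ Let $c = \frac{a}{b} \in S$ be a rational number such that, for $f(z) = z^2 + c$, the critical orbit $\{f^n(0): n \geq 1\}$ is infinite. Then $n \notin \mathcal{Z}(f,0)$ for all $n > 3$.
   Context: For $c \in \mathbb{C}$ put $f_c(z) = z^2 + c$, and let $f_c^n$ denote the $n$-th iterate. For $n \geq 1$ and $\rho > 0$, $D(n,\rho)$ is the set of complex parameters $c$ such that $0$ lies in an attracting basin (for $f_c$) of a complex number $\alpha$ that is periodic of exact period $n$ and satisfies $|(f_c^n)'(\alpha)| \leq \rho$. For $c = \frac{a}{b} \in \mathbb{Q}$ in lowest terms with $b>0$ and $f(z) = z^2 + c$, for every $n \geq 1$ one has $f^n(0) = \frac{a_n}{b^{2^{n-1}}}$ in lowest terms, for an integer $a_n$ coprime to $b$. The Zsigmondy set $\mathcal{Z}(f,0)$ is the set of indices $n \geq 2$ such that $a_n$ has no primitive prime divisor, i.e. such that for every prime $p$ dividing $a_n$ there exists $1 \leq k < n$ with $p \mid a_k$. *)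

theory Defs
  imports "HOL-Analysis.Analysis"
begin

definition quad :: "'a::comm_ring_1 \<Rightarrow> 'a \<Rightarrow> 'a" where
  "quad c z = z\<^sup>2 + c"

definition has_exact_period :: "('a \<Rightarrow> 'a) \<Rightarrow> nat \<Rightarrow> 'a \<Rightarrow> bool" where
  "has_exact_period f n \<alpha> \<longleftrightarrow>
     n \<ge> 1 \<and> (f ^^ n) \<alpha> = \<alpha> \<and> (\<forall>k. 1 \<le> k \<and> k < n \<longrightarrow> (f ^^ k) \<alpha> \<noteq> \<alpha>)"

definition multiplier :: "(complex \<Rightarrow> complex) \<Rightarrow> nat \<Rightarrow> complex \<Rightarrow> complex" where
  "multiplier f n \<alpha> = deriv (f ^^ n) \<alpha>"

text \<open>The basin of a point of period \<open>n\<close> is its basin under the \<open>n\<close>-th iterate. A point attracted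
  to the cycle as a set lies in the basin, in this sense, of exactly one point of the cycle, and the
  multiplier is constant along a cycle; hence \<open>D_set\<close> below does not depend on which of the two
  conventions is used. Super-attracting points (multiplier 0) count as attracting.\<close>

definition basin :: "(complex \<Rightarrow> complex) \<Rightarrow> nat \<Rightarrow> complex \<Rightarrow> complex set" where
  "basin f n \<alpha> = {z. (\<lambda>k. (f ^^ (n * k)) z) \<longlonglongrightarrow> \<alpha>}"

definition attracting :: "(complex \<Rightarrow> complex) \<Rightarrow> nat \<Rightarrow> complex \<Rightarrow> bool" where
  "attracting f n \<alpha> \<longleftrightarrow> has_exact_period f n \<alpha> \<and> cmod (multiplier f n \<alpha>) < 1"

definition D_set :: "nat \<Rightarrow> real \<Rightarrow> complex set" where
  "D_set n \<rho> = {c. \<exists>\<alpha>. attracting (quad c) n \<alpha> \<and> cmod (multiplier (quad c) n \<alpha>) \<le> \<rho>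
                  \<and> 0 \<in> basin (quad c) n \<alpha>}"

text \<open>Real exponents, since \<open>n - 2\<close> is negative for \<open>n = 1\<close>.\<close>

definition rho :: "nat \<Rightarrow> real" where
  "rho n = min (1 / 4) (1 / 2 powr (2 powr (real n - 2)))"

definition S_set :: "complex set" where
  "S_set = UNIV - (\<Union>n\<in>{1..}. D_set n (rho n))"

text \<open>The integer \<open>a\<^sub>n\<close>: the numerator in lowest terms of the \<open>n\<close>-th iterate of 0. The lemma
  \<open>quotient_of_crit_orbit\<close> identifies the corresponding denominator.\<close>

definition crit_num :: "rat \<Rightarrow> nat \<Rightarrow> int" where
  "crit_num c n = fst (quotient_of ((quad c ^^ n) 0))"

definition zsigmondy_set :: "rat \<Rightarrow> nat set" where
  "zsigmondy_set c = {n. n \<ge> 2 \<and>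
     (\<forall>p::int. prime p \<and> p dvd crit_num c n \<longrightarrow> (\<exists>k. 1 \<le> k \<and> k < n \<and> p dvd crit_num c k))}"

lemma quotient_of_crit_orbit:
  assumes "b > 0" "coprime a b" "c = of_int a / of_int b" "n \<ge> 1"
  shows "quotient_of ((quad c ^^ n) 0) = (crit_num c n, b ^ 2 ^ (n - 1))"
proof -
  have q: "quotient_of (of_int x / of_int y) = (x, y)" if "y > 0" "coprime x y" for x y
    using that by (simp add: Fract_of_int_quotient[symmetric] quotient_of_Fract normalize_stable)
  have "\<exists>x. (quad c ^^ Suc m) 0 = of_int x / of_int (b ^ 2 ^ m) \<and> coprime x b" for m
  proof (induction m)
    case 0
    show ?case using assms by (auto simp: quad_def)
  next
    case (Suc m)
    then obtain x where x: "(quad c ^^ Suc m) 0 = of_int x / of_int (b ^ 2 ^ m)" "coprime x b"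
      by blast
    define e :: nat where "e = 2 ^ Suc m - 1"
    have e: "2 ^ Suc m = Suc e" "e \<ge> 1"
      using one_le_power[of "2::nat" m] unfolding e_def power_Suc by linarith+
    let ?y = "x\<^sup>2 + a * b ^ e"
    have "(quad c ^^ Suc (Suc m)) 0 = (of_int x / of_int (b ^ 2 ^ m))\<^sup>2 + of_int a / of_int b"
      using x assms(3) by (simp add: quad_def)
    also have "(of_int x / of_int (b ^ 2 ^ m))\<^sup>2 = (of_int (x\<^sup>2) / of_int (b ^ Suc e) :: rat)"
      unfolding e(1)[symmetric] by (simp add: power_divide power_mult[symmetric] mult.commute)
    also have "\<dots> + of_int a / of_int b = of_int ?y / of_int (b ^ Suc e)"
      using assms(1) by (simp add: field_simps)
    finally have "(quad c ^^ Suc (Suc m)) 0 = of_int ?y / of_int (b ^ 2 ^ Suc m)"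
      unfolding e(1) .
    moreover have "coprime ?y b"
    proof -
      obtain d where d: "e = Suc d" using e(2) by (cases e) auto
      have "?y = (a * b ^ d) * b + x\<^sup>2" by (simp add: d)
      moreover have "coprime (x\<^sup>2) b" using x(2) by simp
      ultimately show ?thesis by (metis coprime_iff_gcd_eq_1 gcd.commute gcd_add_mult)
    qed
    ultimately show ?case by blast
  qed
  from this[of "n - 1"] assms(4) obtain x where
    x: "(quad c ^^ n) 0 = of_int x / of_int (b ^ 2 ^ (n - 1))" "coprime x b" by auto
  have "quotient_of ((quad c ^^ n) 0) = (x, b ^ 2 ^ (n - 1))"
    unfolding x(1) by (rule q) (use x assms in auto)
  then show ?thesis by (simp add: crit_num_def)
qed

end

theory Submission
  imports Defs
begin

text \<open>
  Write \<open>x\<^sub>n\<close> for the \<open>n\<close>-th iterate of 0 and \<open>a\<^sub>n\<close> for its numerator. The proof compares an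
  arithmetic upper bound for \<open>\<bar>a\<^sub>n\<bar>\<close>, valid when \<open>n\<close> lies in the Zsigmondy set, with an analytic
  lower bound.

  Upper bound. The polynomial \<open>f\<^sup>i(z)\<close> depends on \<open>z\<close> only through \<open>z\<^sup>2\<close>, so \<open>x\<^sub>k\<^sub>+\<^sub>i \<equiv> x\<^sub>i\<close> modulo
  \<open>a\<^sub>k\<^sup>2\<close> (\<open>orbit_num_add_cong_mod_square\<close>). Hence if \<open>k\<close> is the first index with \<open>p\<close> dividing \<open>a\<^sub>k\<close>,
  then \<open>p\<close> divides \<open>a\<^sub>n\<close> only when \<open>k\<close> divides \<open>n\<close>, and then with the same exponent as in \<open>a\<^sub>k\<close>
  (\<open>multiplicity_orbit_num_first\<close>). If \<open>a\<^sub>n\<close> has no primitive prime divisor, every such \<open>k\<close> is a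
  proper divisor of \<open>n\<close>, so \<open>a\<^sub>n\<close> divides the product of the \<open>a\<^sub>k\<close> with \<open>k \<le> n div 2\<close>.

  Lower bound. It remains to see that \<open>\<bar>a\<^sub>n\<bar>\<close> exceeds that product for \<open>n \<ge> 4\<close>. For \<open>c > 0\<close> and for
  \<open>c < -2\<close> the numerators essentially square at each step, which is more than enough. For
  \<open>-2 < c < 0\<close> the orbit stays in \<open>[-2, 2]\<close>, so the product is at most about \<open>b\<close> to the power
  \<open>2 ^ (n div 2)\<close>, while \<open>\<bar>a\<^sub>n\<bar> = \<bar>x\<^sub>n\<bar> * b ^ 2 ^ (n - 1)\<close>; the inequality can fail only if \<open>x\<^sub>n\<close> is
  extremely close to 0. This is where the hypothesis \<open>c \<in> S\<close> enters: a close return of 0 to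
  itself makes \<open>f\<^sup>n\<close> a contraction near 0, and its fixed point is an attracting periodic point with
  tiny multiplier and with 0 in its basin (\<open>close_return_imp_mem_D_set\<close>). The
  quantitative form of this suffices except for finitely many pairs \<open>(n, b)\<close>, which are settled by
  computing the numerators.
\<close>

section \<open>Numerators along the critical orbit\<close>

text \<open>The recursion for \<open>z\<^sup>2 + a / b\<close> after multiplying the \<open>n\<close>-th iterate by \<open>b ^ 2 ^ (n - 1)\<close>.\<close>
primrec orbit_num :: "int \<Rightarrow> int \<Rightarrow> nat \<Rightarrow> int" where
  "orbit_num a b 0 = 0"
| "orbit_num a b (Suc n) = (orbit_num a b n)\<^sup>2 + a * b ^ (2 ^ n - 1)"

lemma quad_orbit_eq_orbit_num:
  assumes "b \<noteq> 0"
  shows "(quad (of_int a / of_int b :: 'a::field_char_0) ^^ n) 0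
           = of_int (orbit_num a b n) / of_int b ^ 2 ^ (n - 1)"
proof (induction n)
  case 0
  show ?case by simp
next
  case (Suc n)
  show ?case
  proof (cases n)
    case 0
    then show ?thesis using assms by (simp add: quad_def)
  next
    case (Suc m)
    define B where "B = (of_int b :: 'a)"
    have B: "B \<noteq> 0" using assms by (simp add: B_def)
    obtain e where e: "(2::nat) ^ n = Suc e"
      by (metis gr0_implies_Suc zero_less_power zero_less_numeral)
    have sq: "(B ^ 2 ^ (n - 1))\<^sup>2 = B ^ Suc e"
      using Suc e by (simp add: power_mult[symmetric] mult.commute)
    have "(quad (of_int a / B) ^^ Suc n) 0
            = (of_int (orbit_num a b n) / B ^ 2 ^ (n - 1))\<^sup>2 + of_int a / B"
      by (simp only: funpow.simps o_apply Suc.IH[folded B_def]) (simp add: quad_def B_def)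
    also have "\<dots> = (of_int (orbit_num a b n))\<^sup>2 / B ^ Suc e + of_int a / B"
      by (simp only: power_divide sq)
    also have "\<dots> = of_int (orbit_num a b (Suc n)) / B ^ Suc e"
      using B e by (simp add: field_simps B_def)
    finally show ?thesis using e by (simp add: B_def)
  qed
qed

text \<open>From the second step on, the summand containing \<open>a\<close> is a multiple of \<open>b\<close>, so modulo \<open>b\<close> the
  recursion is squaring. Besides reducing the fractions, this makes \<open>b\<close> invertible modulo every
  prime that divides a numerator.\<close>
lemma coprime_orbit_num:
  assumes "coprime a b" "n \<ge> 1"
  shows "coprime (orbit_num a b n) b"
  using \<open>n \<ge> 1\<close>
proof (induction n rule: nat_induct_at_least)
  case base
  show ?case using assms by simp
next
  case (Suc n)
  have "(2::nat) ^ 1 \<le> 2 ^ n" using Suc by (intro power_increasing) auto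
  then obtain d where d: "(2::nat) ^ n - 1 = Suc d"
    by (cases "(2::nat) ^ n - 1") auto
  have "orbit_num a b (Suc n) = (a * b ^ d) * b + (orbit_num a b n)\<^sup>2"
    unfolding orbit_num.simps d by simp
  moreover have "coprime ((orbit_num a b n)\<^sup>2) b" using Suc.IH by simp
  ultimately show ?case by (metis coprime_iff_gcd_eq_1 gcd.commute gcd_add_mult)
qed

lemma crit_num_eq_orbit_num:
  assumes "b > 0" "coprime a b" "n \<ge> 1"
  shows "crit_num (of_int a / of_int b) n = orbit_num a b n"
proof -
  let ?c = "of_int a / of_int b :: rat"
  have "(quad ?c ^^ n) 0 = of_int (crit_num ?c n) / of_int (b ^ 2 ^ (n - 1))"
    using quotient_of_div[OF quotient_of_crit_orbit[OF assms(1,2) refl assms(3)]] .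
  moreover have "(quad ?c ^^ n) 0 = of_int (orbit_num a b n) / of_int b ^ 2 ^ (n - 1)"
    using assms by (intro quad_orbit_eq_orbit_num) simp
  ultimately show ?thesis using assms(1) by simp
qed

section \<open>Rigid divisibility\<close>

text \<open>Since \<open>f(z) = f(-z)\<close>, the polynomial \<open>f\<^sup>i(z)\<close> has no linear term in \<open>z\<close>, so evaluating it
  at \<open>x\<^sub>k\<close> and at 0 gives the same value modulo the square of the numerator of \<open>x\<^sub>k\<close>. The power of
  \<open>b\<close> accounts for the different denominators of \<open>x\<^sub>k\<^sub>+\<^sub>i\<close> and \<open>x\<^sub>i\<close>.\<close>
lemma orbit_num_add_cong_mod_square:
  assumes "i \<ge> 1"
  shows "(orbit_num a b k)\<^sup>2 dvd
           orbit_num a b (k + i) - orbit_num a b i * b ^ (2 ^ (k + i - 1) - 2 ^ (i - 1))"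
  using assms
proof (induction i rule: nat_induct_at_least)
  case base
  show ?case by simp
next
  case (Suc i)
  define u v M where "u = orbit_num a b (k + i)" and "v = orbit_num a b i"
    and "M = (orbit_num a b k)\<^sup>2"
  define s :: nat where "s = 2 ^ (k + i - 1) - 2 ^ (i - 1)"
  have pow: "(2::nat) ^ i \<le> 2 ^ (k + i)" "(1::nat) \<le> 2 ^ i" "2 ^ i = (2::nat) * 2 ^ (i - 1)"
       "2 ^ (k + i) = (2::nat) * 2 ^ (k + i - 1)"
    using Suc.hyps by (auto simp flip: power_Suc)
  have s2: "2 ^ (k + i) - 2 ^ i = 2 * s" using pow unfolding s_def by linarith
  have split: "2 ^ (k + i) - 1 = (2 ^ i - 1) + 2 * s" using pow s2 by linarith
  \<comment> \<open>One step of the recursion turns the difference into a difference of squares.\<close>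
  have "M dvd u - v * b ^ s" using Suc.IH by (simp add: u_def v_def M_def s_def)
  then have "M dvd (u - v * b ^ s) * (u + v * b ^ s)" by simp
  moreover have "(u - v * b ^ s) * (u + v * b ^ s)
      = (u\<^sup>2 + a * b ^ (2 ^ (k + i) - 1)) - (v\<^sup>2 + a * b ^ (2 ^ i - 1)) * b ^ (2 * s)"
    unfolding split power_add[of b "2 ^ i - 1"]
    by (simp add: algebra_simps power2_eq_square mult_2_right power_add[of b s s])
  ultimately show ?case by (simp add: s2 u_def v_def M_def)
qed

text \<open>Rigid divisibility. Let \<open>e\<close> be the exponent of \<open>p\<close> in the numerator of \<open>x\<^sub>k\<close>. The congruence
  above holds modulo \<open>p ^ (2 * e)\<close>, and \<open>2 * e \<ge> e + 1\<close>, so it decides divisibility both by \<open>p\<close> and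
  by \<open>p ^ (e + 1)\<close>. Thus \<open>n\<close> may be replaced by \<open>n - k\<close> until it is at most \<open>k\<close>, and minimality
  of \<open>k\<close> forces this descent to end exactly at \<open>k\<close>.\<close>
lemma multiplicity_orbit_num_first:
  fixes p :: int
  assumes "prime p" "coprime a b"
    and k: "k \<ge> 1" "p dvd orbit_num a b k" "orbit_num a b k \<noteq> 0"
    and first: "\<And>j. 1 \<le> j \<Longrightarrow> j < k \<Longrightarrow> \<not> p dvd orbit_num a b j"
    and "n \<ge> 1" "p dvd orbit_num a b n"
  shows "k dvd n \<and> \<not> p ^ Suc (multiplicity p (orbit_num a b k)) dvd orbit_num a b n"
  using \<open>n \<ge> 1\<close> \<open>p dvd orbit_num a b n\<close>
proof (induction n rule: less_induct)
  case (less n)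
  define e where "e = multiplicity p (orbit_num a b k)"
  have pu: "\<not> is_unit p" using \<open>prime p\<close> by auto
  have e1: "e \<ge> 1"
    using k pu unfolding e_def by (metis dvd_def multiplicity_geI power_one_right)
  consider "n < k" | "n = k" | "n > k" by linarith
  then show ?case
  proof cases
    case 1
    then show ?thesis using first less.prems by blast
  next
    case 2
    have "\<not> p ^ Suc e dvd orbit_num a b k"
      unfolding power_dvd_iff_le_multiplicity[OF k(3) pu] e_def by simp
    with 2 show ?thesis by (simp add: e_def)
  next
    case 3
    define i where "i = n - k"
    have i: "i \<ge> 1" "n = k + i" "i < n" using 3 k(1) by (auto simp: i_def)
    define s :: nat where "s = 2 ^ (n - 1) - 2 ^ (i - 1)"
    have "\<not> p dvd b"
      using coprime_orbit_num[OF \<open>coprime a b\<close> k(1)] k(2) pu by (meson coprime_common_divisor)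
    then have pb: "coprime (p ^ j) (b ^ s)" for j
      using \<open>prime p\<close> by (simp add: prime_imp_coprime)
    have "p ^ Suc e dvd (p ^ e)\<^sup>2"
      using e1 unfolding power_mult[symmetric] by (intro le_imp_power_dvd) simp
    also have "(p ^ e)\<^sup>2 dvd (orbit_num a b k)\<^sup>2"
      unfolding e_def by (intro dvd_power_same multiplicity_dvd)
    finally have "p ^ Suc e dvd orbit_num a b n - orbit_num a b i * b ^ s"
      using orbit_num_add_cong_mod_square[OF i(1), of a b k] i(2) dvd_trans unfolding s_def by blast
    then have "p ^ j dvd orbit_num a b n - orbit_num a b i * b ^ s" if "j \<le> Suc e" for j
      using that by (meson dvd_trans le_imp_power_dvd)
    then have iff: "p ^ j dvd orbit_num a b n \<longleftrightarrow> p ^ j dvd orbit_num a b i" if "j \<le> Suc e" for j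
      using that pb by (metis coprime_dvd_mult_left_iff dvd_diff_right_iff dvd_diff_left_iff)
    from iff[of 1] less.prems have "p dvd orbit_num a b i" by simp
    from less.IH[OF i(3,1) this] iff[of "Suc e"] show ?thesis
      by (auto simp: e_def i(2))
  qed
qed

text \<open>Each prime power in the numerator of \<open>x\<^sub>n\<close> already divides the numerator of \<open>x\<^sub>k\<close>, where \<open>k\<close> is
  the index at which the prime first occurs; being a proper divisor of \<open>n\<close>, this \<open>k\<close> is at most
  \<open>n div 2\<close>.\<close>
lemma orbit_num_dvd_prod_if_no_primitive_divisor:
  fixes a b :: int
  assumes "coprime a b" "n \<ge> 1"
    and nz: "\<And>k. k \<ge> 1 \<Longrightarrow> orbit_num a b k \<noteq> 0"
    and noprim: "\<And>p. prime p \<Longrightarrow> p dvd orbit_num a b n \<Longrightarrow>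
                   \<exists>k\<ge>1. k < n \<and> p dvd orbit_num a b k"
  shows "orbit_num a b n dvd (\<Prod>k=1..n div 2. orbit_num a b k)"
proof (rule multiplicity_le_imp_dvd)
  show "orbit_num a b n \<noteq> 0" using nz assms(2) by blast
next
  fix p :: int
  assume p: "prime p"
  let ?P = "\<Prod>k=1..n div 2. orbit_num a b k"
  have P0: "?P \<noteq> 0" using nz by simp
  show "multiplicity p (orbit_num a b n) \<le> multiplicity p ?P"
  proof (cases "p dvd orbit_num a b n")
    case False
    then show ?thesis by (simp add: not_dvd_imp_multiplicity_0)
  next
    case True
    define k where "k = (LEAST k. k \<ge> 1 \<and> p dvd orbit_num a b k)"
    obtain k' where k': "k' \<ge> 1 \<and> p dvd orbit_num a b k'" "k' < n" using noprim[OF p True] by blast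
    have k: "k \<ge> 1 \<and> p dvd orbit_num a b k"
      unfolding k_def by (rule LeastI[where k = k']) (rule k'(1))
    have kn: "k < n"
      using Least_le[where P = "\<lambda>k. k \<ge> 1 \<and> p dvd orbit_num a b k", OF k'(1)] k'(2)
      unfolding k_def by linarith
    have first: "\<not> p dvd orbit_num a b j" if "1 \<le> j" "j < k" for j
      using not_less_Least[of j "\<lambda>k. k \<ge> 1 \<and> p dvd orbit_num a b k"] that unfolding k_def by blast
    have kdvd: "k dvd n" and
      notdvd: "\<not> p ^ Suc (multiplicity p (orbit_num a b k)) dvd orbit_num a b n"
      using multiplicity_orbit_num_first[OF p assms(1) _ _ nz first assms(2) True] k by blast+
    from kdvd obtain q where q: "n = k * q" by blast
    with kn have "q \<ge> 2" by (cases q; cases "q - 1") auto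
    with q have "k * 2 \<le> n" by simp
    then have "k \<in> {1..n div 2}" using k by simp
    then have "orbit_num a b k dvd ?P" by (simp add: dvd_prodI)
    then have "multiplicity p (orbit_num a b k) \<le> multiplicity p ?P"
      using P0 by (rule dvd_imp_multiplicity_le)
    moreover have "multiplicity p (orbit_num a b n) \<le> multiplicity p (orbit_num a b k)"
      using notdvd by (meson multiplicity_dvd' not_less_eq_eq)
    ultimately show ?thesis by linarith
  qed
qed

section \<open>Growth of the numerators for positive parameters and for parameters below -2\<close>

text \<open>For positive \<open>a\<close> the numerators increase and each exceeds the square of its predecessor, hence
  by induction also the product of all its predecessors.\<close>
lemma prod_orbit_num_less_if_pos:
  assumes "a > 0" "b > 0" "n \<ge> 2"
  shows "(\<Prod>k=1..n div 2. \<bar>orbit_num a b k\<bar>) < \<bar>orbit_num a b n\<bar>"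
proof -
  have step: "(orbit_num a b k)\<^sup>2 < orbit_num a b (Suc k)" for k
    using assms by simp
  have pos: "orbit_num a b (Suc k) \<ge> 1" for k
    using step[of k] zero_le_power2[of "orbit_num a b k"] by linarith
  have inc: "orbit_num a b k < orbit_num a b (Suc k)" for k
    using step[of k] pos[of "k - 1"] self_le_power[of "orbit_num a b k" 2] by (cases k) auto
  have prod: "(\<Prod>k=1..Suc m. orbit_num a b k) < orbit_num a b (Suc (Suc m))" for m
  proof (induction m)
    case 0
    show ?case using inc[of 1] by (simp add: numeral_2_eq_2)
  next
    case (Suc m)
    have "(\<Prod>k=1..Suc (Suc m). orbit_num a b k)
            = (\<Prod>k=1..Suc m. orbit_num a b k) * orbit_num a b (Suc (Suc m))"
      by (subst prod.nat_ivl_Suc') (simp_all del: prod.cl_ivl_Suc orbit_num.simps add: mult.commute)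
    also have "\<dots> \<le> (orbit_num a b (Suc (Suc m)))\<^sup>2"
      unfolding power2_eq_square using Suc pos[of "Suc m"] by (intro mult_right_mono) linarith+
    also have "\<dots> < orbit_num a b (Suc (Suc (Suc m)))" by (rule step)
    finally show ?case .
  qed
  obtain m where m: "n div 2 = Suc m" using assms(3) by (cases "n div 2") auto
  have "(\<Prod>k=1..n div 2. \<bar>orbit_num a b k\<bar>) = (\<Prod>k=1..Suc m. orbit_num a b k)"
    unfolding m
  proof (intro prod.cong refl)
    fix k assume "k \<in> {1..Suc m}"
    then show "\<bar>orbit_num a b k\<bar> = orbit_num a b k" using pos[of "k - 1"] by (cases k) auto
  qed
  also have "\<dots> < orbit_num a b (Suc (Suc m))" by (rule prod)
  also have "\<dots> \<le> orbit_num a b n"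
  proof (rule lift_Suc_mono_le[of "orbit_num a b"])
    show "orbit_num a b k \<le> orbit_num a b (Suc k)" for k by (rule less_imp_le[OF inc])
    show "Suc (Suc m) \<le> n" using m assms(3) by linarith
  qed
  finally show ?thesis by linarith
qed

text \<open>With the loss of a factor 2 in the squaring step, a term need no longer dominate the
  product of all its predecessors, but it still dominates the product of those at distance at
  least 2: doubling from one term to the next compensates the loss. This suffices because
  \<open>n div 2 \<le> n - 2\<close>.\<close>
lemma prod_less_if_doubly_exponential:
  fixes A :: "nat \<Rightarrow> int"
  assumes first: "A 1 > 0" and two: "A 2 \<ge> 4" "A 2 \<ge> 2 * A 1"
    and step: "\<And>k. k \<ge> 1 \<Longrightarrow> (A k)\<^sup>2 \<le> 2 * A (Suc k)"
    and n: "n \<ge> 4"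
  shows "(\<Prod>k=1..n div 2. A k) < A n"
proof -
  have ge4: "A (k + 2) \<ge> 4" for k
  proof (induction k)
    case (Suc k)
    have "4 * 4 \<le> A (k + 2) * A (k + 2)" using Suc by (intro mult_mono) auto
    then show ?case using step[of "k + 2"] by (simp add: power2_eq_square)
  qed (use two in \<open>simp add: numeral_2_eq_2\<close>)
  have pos: "A (Suc k) > 0" for k
    using ge4[of "k - 1"] first by (cases k) auto
  have double: "2 * A (Suc k) \<le> A (Suc (Suc k))" for k
  proof (cases k)
    case 0
    then show ?thesis using two by (simp add: numeral_2_eq_2)
  next
    case (Suc j)
    have "4 * A (Suc k) \<le> A (Suc k) * A (Suc k)"
      using ge4[of j] Suc by (intro mult_right_mono) auto
    then show ?thesis using step[of "Suc k"] by (simp add: power2_eq_square)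
  qed
  have prod: "(\<Prod>k=1..m. A k) < A (Suc (Suc m))" for m
  proof (induction m)
    case 0
    show ?case using two by (simp add: numeral_2_eq_2)
  next
    case (Suc m)
    have "2 * (\<Prod>k=1..Suc m. A k) = (\<Prod>k=1..m. A k) * (2 * A (Suc m))" by simp
    also have "\<dots> < A (Suc (Suc m)) * (2 * A (Suc m))"
      using Suc pos[of m] by (intro mult_strict_right_mono) auto
    also have "\<dots> \<le> A (Suc (Suc m)) * A (Suc (Suc m))"
      using double[of m] pos[of "Suc m"] by (intro mult_left_mono) auto
    also have "\<dots> \<le> 2 * A (Suc (Suc (Suc m)))"
      using step[of "Suc (Suc m)"] by (simp add: power2_eq_square)
    finally show ?case by simp
  qed
  have "A (Suc k) \<le> A (Suc (Suc k))" for k using double[of k] pos[of k] by linarith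
  then have mono: "A (Suc i) \<le> A (Suc j)" if "i \<le> j" for i j
    using lift_Suc_mono_le[of "\<lambda>k. A (Suc k)"] that by blast
  have "A (Suc (Suc (n div 2))) \<le> A (Suc (n - 1))" using n by (intro mono) linarith
  then show ?thesis using prod[of "n div 2"] n by simp
qed

text \<open>For \<open>c < -2\<close> one has \<open>\<bar>x\<^sub>k\<bar> \<ge> \<bar>c\<bar>\<close> for all \<open>k \<ge> 1\<close>, hence
  \<open>x\<^sub>k\<^sup>2 \<ge> 2 * \<bar>c\<bar>\<close>: adding \<open>c\<close> cancels at most half of the square. In terms of numerators these
  are the facts \<open>lower\<close> and \<open>half\<close>, and each yields the next instance of the other.\<close>
lemma prod_orbit_num_less_if_less_minus_2:
  assumes "b > 0" "a < - 2 * b" "n \<ge> 4"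
  shows "(\<Prod>k=1..n div 2. \<bar>orbit_num a b k\<bar>) < \<bar>orbit_num a b n\<bar>"
proof (rule prod_less_if_doubly_exponential)
  have num2: "orbit_num a b 2 = a * (a + b)" by (simp add: numeral_2_eq_2 algebra_simps)
  have num2': "\<bar>orbit_num a b 2\<bar> = (- a) * (- a - b)"
    unfolding num2 using assms by (simp add: abs_mult)
  have "(- a) * 2 \<le> (- a) * (- a - b)" using assms by (intro mult_left_mono) linarith+
  then show "\<bar>orbit_num a b 2\<bar> \<ge> 4" "\<bar>orbit_num a b 2\<bar> \<ge> 2 * \<bar>orbit_num a b 1\<bar>"
    unfolding num2' using assms by (linarith, simp)
  show "\<bar>orbit_num a b 1\<bar> > 0" using assms by simp
  have half: "2 * (- a * b ^ (2 ^ k - 1)) \<le> (orbit_num a b k)\<^sup>2"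
    if "- a * b ^ (2 ^ (k - 1) - 1) \<le> \<bar>orbit_num a b k\<bar>" "k \<ge> 1" for k
  proof -
    obtain d :: nat where d: "2 ^ (k - 1) = Suc d"
      by (metis gr0_implies_Suc zero_less_power zero_less_numeral)
    have "(2::nat) ^ k = 2 * 2 ^ (k - 1)" using that(2) by (simp flip: power_Suc)
    then have k: "(2::nat) ^ k - 1 = Suc (2 * d)" using d by simp
    have "2 * (- a * b ^ (2 ^ k - 1)) = (- a * b ^ (2 * d)) * (2 * b)" unfolding k by simp
    also have "\<dots> \<le> (- a * b ^ (2 * d)) * (- a)"
      using assms by (intro mult_left_mono mult_nonneg_nonneg) auto
    also have "\<dots> = (- a * b ^ d)\<^sup>2" by (simp add: power2_eq_square mult_2 power_add)
    also have "\<dots> \<le> \<bar>orbit_num a b k\<bar>\<^sup>2"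
      using that(1) d assms by (intro power_mono mult_nonneg_nonneg) auto
    finally show ?thesis by simp
  qed
  have lower: "- a * b ^ (2 ^ (k - 1) - 1) \<le> \<bar>orbit_num a b k\<bar>" if "k \<ge> 1" for k
    using that
  proof (induction k rule: nat_induct_at_least)
    case base
    then show ?case by simp
  next
    case (Suc k)
    from half[OF Suc.IH Suc.hyps] show ?case by simp
  qed
  show "\<bar>orbit_num a b k\<bar>\<^sup>2 \<le> 2 * \<bar>orbit_num a b (Suc k)\<bar>" if "k \<ge> 1" for k
  proof -
    define t where "t = a * b ^ (2 ^ k - 1)"
    have "2 * - t \<le> (orbit_num a b k)\<^sup>2"
      using half[OF lower[OF that] that] unfolding mult_minus_left t_def .
    then have "(orbit_num a b k)\<^sup>2 \<le> 2 * ((orbit_num a b k)\<^sup>2 + t)" by simp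
    also have "\<dots> \<le> 2 * \<bar>(orbit_num a b k)\<^sup>2 + t\<bar>" by (intro mult_left_mono abs_ge_self) simp
    finally have "(orbit_num a b k)\<^sup>2 \<le> 2 * \<bar>(orbit_num a b k)\<^sup>2 + t\<bar>" .
    then show ?thesis by (simp add: t_def)
  qed
qed (use assms in auto)

section \<open>A small critical value forces an attracting cycle\<close>

lemma has_field_derivative_quad_funpow:
  fixes c z :: "'a::real_normed_field"
  shows "((quad c ^^ m) has_field_derivative 2 ^ m * (\<Prod>k<m. (quad c ^^ k) z)) (at z)"
proof (induction m)
  case 0
  show ?case by (simp add: id_def)
next
  case (Suc m)
  have "((\<lambda>w. ((quad c ^^ m) w)\<^sup>2 + c) has_field_derivative
          2 ^ Suc m * (\<Prod>k<Suc m. (quad c ^^ k) z)) (at z)"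
    by (auto intro!: derivative_eq_intros Suc simp: algebra_simps)
  then show ?case by (simp add: quad_def[abs_def] o_def)
qed

lemma funpow_quad_of_real:
  "(quad (of_real c) ^^ k) (of_real z) = (of_real ((quad c ^^ k) z) :: complex)"
  by (induction k) (simp_all add: quad_def)

text \<open>The interval \<open>[c, -c]\<close> is invariant but shrinks to a point as \<open>c\<close> tends to 0, while
  \<open>[-1, 1]\<close> is invariant only for \<open>c \<ge> -1\<close>. The larger of the two is invariant for all \<open>c\<close> in
  \<open>[-2, 0]\<close> and always contains a neighbourhood of 0 of fixed size, in which a perturbed starting
  point can be placed.\<close>
lemma quad_orbit_bound:
  fixes c z :: real
  assumes "- 2 \<le> c" "c \<le> 0" "\<bar>z\<bar> \<le> max 1 (- c)"
  shows "\<bar>(quad c ^^ k) z\<bar> \<le> max 1 (- c)"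
proof (induction k)
  case 0
  show ?case using assms by simp
next
  case (Suc k)
  define w M where "w = (quad c ^^ k) z" and "M = max 1 (- c)"
  have "w\<^sup>2 \<le> M\<^sup>2" using Suc unfolding w_def M_def by (metis abs_le_square_iff abs_of_nonneg le_max_iff_disj zero_le_one)
  moreover have "M\<^sup>2 + c \<le> M"
  proof (cases "- c \<le> 1")
    case True
    then show ?thesis using assms by (simp add: M_def)
  next
    case False
    then have "M = - c" by (simp add: M_def)
    moreover have "(- c) * (- c) \<le> 2 * (- c)" using assms by (intro mult_right_mono) auto
    ultimately show ?thesis by (simp add: power2_eq_square)
  qed
  moreover have "- M \<le> c" by (simp add: M_def)
  moreover have "0 \<le> w\<^sup>2" by simp
  ultimately have "\<bar>w\<^sup>2 + c\<bar> \<le> M" by linarith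
  then show ?case by (simp add: quad_def[of c "(quad c ^^ k) z"] w_def M_def)
qed

text \<open>By the chain rule the derivative of \<open>f\<^sup>m\<close> contains the starting point as a factor; the other
  \<open>m - 1\<close> orbit points have absolute value at most 2.\<close>
lemma abs_deriv_quad_funpow_le:
  fixes c z :: real
  assumes c: "- 2 \<le> c" "c \<le> 0" and z: "\<bar>z\<bar> \<le> 1" and "m \<ge> 1"
  shows "\<bar>2 ^ m * (\<Prod>k<m. (quad c ^^ k) z)\<bar> \<le> 4 ^ m / 2 * \<bar>z\<bar>"
proof -
  obtain d where d: "m = Suc d" using \<open>m \<ge> 1\<close> by (cases m) auto
  have "\<bar>(quad c ^^ k) z\<bar> \<le> 2" for k
    using quad_orbit_bound[OF c, of z k] z c by linarith
  then have "(\<Prod>k<d. \<bar>(quad c ^^ Suc k) z\<bar>) \<le> (\<Prod>k<d. 2)"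
    by (intro prod_mono conjI abs_ge_zero)
  then have "\<bar>z\<bar> * (\<Prod>k<d. \<bar>(quad c ^^ Suc k) z\<bar>) \<le> \<bar>z\<bar> * 2 ^ d" by (intro mult_left_mono) auto
  then have "2 ^ m * (\<bar>z\<bar> * (\<Prod>k<d. \<bar>(quad c ^^ Suc k) z\<bar>)) \<le> 2 ^ m * (\<bar>z\<bar> * 2 ^ d)"
    by (rule mult_left_mono) simp
  also have "\<dots> = 4 ^ m / 2 * \<bar>z\<bar>" by (simp add: d flip: power_mult_distrib)
  finally have "2 ^ m * (\<bar>z\<bar> * (\<Prod>k<d. \<bar>(quad c ^^ Suc k) z\<bar>)) \<le> 4 ^ m / 2 * \<bar>z\<bar>" .
  moreover have "(\<Prod>k<m. (quad c ^^ k) z) = z * (\<Prod>k<d. (quad c ^^ Suc k) z)"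
    unfolding d by (subst prod.lessThan_Suc_shift) simp
  ultimately show ?thesis by (simp only: abs_mult abs_prod power_abs abs_numeral)
qed

text \<open>The contraction argument below gives convergence along multiples of \<open>n\<close>, whereas the basin is
  defined with the exact period \<open>m\<close>. Continuity of the iterates \<open>f ^^ (m * i)\<close> at the fixed point
  transfers the convergence to each of the finitely many residue classes of multiples of \<open>m\<close>
  modulo \<open>n\<close>.\<close>
lemma basin_period_dvd:
  assumes cont: "\<And>z. isCont f z" and per: "(f ^^ m) \<alpha> = \<alpha>" and dvd: "m dvd n" "n \<ge> 1"
  shows "basin f n \<alpha> \<subseteq> basin f m \<alpha>"
proof
  fix z assume "z \<in> basin f n \<alpha>"
  then have lim: "(\<lambda>j. (f ^^ (n * j)) z) \<longlonglongrightarrow> \<alpha>" by (simp add: basin_def)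
  obtain d where d: "n = m * d" "d \<ge> 1"
    using dvd by (metis dvd_def mult_0_right not_one_le_zero neq0_conv One_nat_def Suc_leI)
  have contk: "isCont (f ^^ k) w" for k w
    by (induction k) (auto intro!: isCont_o2[OF _ cont] simp: id_def o_def)
  have perk: "(f ^^ (m * i)) \<alpha> = \<alpha>" for i
    by (induction i) (simp_all add: per funpow_add)
  have "(\<lambda>k. (f ^^ (m * k)) z) \<longlonglongrightarrow> \<alpha>"
  proof (rule tendstoI)
    fix e :: real assume "e > 0"
    have "\<forall>\<^sub>F j in sequentially. dist ((f ^^ (m * i)) ((f ^^ (n * j)) z)) \<alpha> < e" for i
      using isCont_tendsto_compose[OF contk lim, of "m * i"] \<open>e > 0\<close> perk[of i]
      by (auto dest: tendstoD)
    then have "\<forall>\<^sub>F j in sequentially. \<forall>i\<in>{..<d}. dist ((f ^^ (m * i)) ((f ^^ (n * j)) z)) \<alpha> < e"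
      by (intro eventually_ball_finite) auto
    then obtain J where J: "\<And>j i. j \<ge> J \<Longrightarrow> i < d \<Longrightarrow>
        dist ((f ^^ (m * i)) ((f ^^ (n * j)) z)) \<alpha> < e"
      unfolding eventually_sequentially by blast
    have "dist ((f ^^ (m * k)) z) \<alpha> < e" if "k \<ge> J * d" for k
    proof -
      have "k div d \<ge> J" using that d(2) by (simp add: less_eq_div_iff_mult_less_eq)
      moreover have "k mod d < d" using d(2) by simp
      moreover have "m * k = m * (k mod d) + n * (k div d)"
        unfolding d(1) by (metis distrib_left mod_mult_div_eq mult.assoc)
      ultimately show ?thesis using J[of "k div d" "k mod d"] by (simp add: funpow_add)
    qed
    then show "\<forall>\<^sub>F k in sequentially. dist ((f ^^ (m * k)) z) \<alpha> < e"
      unfolding eventually_sequentially by blast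
  qed
  then show "z \<in> basin f m \<alpha>" by (simp add: basin_def)
qed

lemma has_exact_period_exists_dvd:
  assumes "(f ^^ n) \<alpha> = \<alpha>" "n \<ge> 1"
  shows "\<exists>m. has_exact_period f m \<alpha> \<and> m dvd n"
proof -
  define m where "m = (LEAST m. m \<ge> 1 \<and> (f ^^ m) \<alpha> = \<alpha>)"
  have m: "m \<ge> 1 \<and> (f ^^ m) \<alpha> = \<alpha>"
    unfolding m_def by (rule LeastI[of _ n]) (use assms in simp)
  have least: "(f ^^ k) \<alpha> \<noteq> \<alpha>" if "1 \<le> k" "k < m" for k
    using not_less_Least[of k "\<lambda>m. m \<ge> 1 \<and> (f ^^ m) \<alpha> = \<alpha>"] that unfolding m_def by blast
  have "(f ^^ (n mod m)) \<alpha> = \<alpha>" using funpow_mod_eq[where f = f and n = m and m = n and x = \<alpha>] m assms by simp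
  moreover have "n mod m < m" using m by simp
  ultimately have "n mod m = 0" using least[of "n mod m"] by linarith
  then show ?thesis using m least by (auto simp: has_exact_period_def)
qed

lemma rho_antimono: "m \<le> n \<Longrightarrow> rho n \<le> rho m"
  unfolding rho_def by (intro min.mono divide_left_mono powr_mono) auto

lemma rho_eq: "n \<ge> 3 \<Longrightarrow> rho n = 1 / 2 ^ (2 ^ (n - 2))"
proof -
  assume n: "n \<ge> 3"
  have "(2::real) powr (real n - 2) = 2 powr (real (n - 2))" using n by (simp add: of_nat_diff)
  also have "\<dots> = real (2 ^ (n - 2))" by (simp only: powr_realpow) simp
  finally have "2 powr (2 powr (real n - 2)) = (2::real) ^ 2 ^ (n - 2)"
    by (simp only: powr_realpow)
  moreover have "(2::real) ^ 2 \<le> 2 ^ 2 ^ (n - 2)"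
  proof (rule power_increasing)
    show "2 \<le> (2::nat) ^ (n - 2)" using n power_increasing[of 1 "n - 2" "2::nat"] by simp
  qed simp
  ultimately show ?thesis by (simp add: rho_def field_simps min_def)
qed

text \<open>On the interval of radius \<open>r = 2 * \<bar>x\<^sub>n\<bar>\<close> about 0 the derivative of \<open>f\<^sup>n\<close> is at most
  \<open>4 ^ n / 2 * r = 4 ^ n * \<bar>x\<^sub>n\<bar>\<close>, which is at most \<open>rho n \<le> 1 / 4\<close>. As 0 moves only by \<open>r / 2\<close>, the
  interval is mapped into itself, and the orbit of 0 converges to the fixed point. The exact
  period \<open>m\<close> of that point may be a proper divisor of \<open>n\<close>, but the derivative bound for \<open>f\<^sup>n\<close> covers
  \<open>f\<^sup>m\<close> as well and \<open>rho\<close> is nonincreasing, so the multiplier meets the bound for its own period.\<close>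
lemma close_return_imp_mem_D_set:
  fixes c :: real
  assumes c: "- 2 \<le> c" "c \<le> 0" and n: "n \<ge> 1"
    and close: "4 ^ n * \<bar>(quad c ^^ n) 0\<bar> \<le> rho n"
  shows "\<exists>m\<ge>1. complex_of_real c \<in> D_set m (rho m)"
proof -
  define F x r where "F = quad c ^^ n" and "x = \<bar>F 0\<bar>" and "r = 2 * x"
  have rho4: "rho n \<le> 1 / 4" by (simp add: rho_def)
  have x0: "x \<ge> 0" by (simp add: x_def)
  have nx: "4 ^ n * x \<le> 1 / 4" using close rho4 by (simp add: x_def F_def)
  have "1 * x \<le> 4 ^ n * x" using x0 by (intro mult_right_mono) auto
  then have r1: "r \<le> 1" using nx by (simp add: r_def)
  have deriv_small: "\<bar>2 ^ m * (\<Prod>k<m. (quad c ^^ k) z)\<bar> \<le> 4 ^ n * x"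
    if "\<bar>z\<bar> \<le> r" "1 \<le> m" "m \<le> n" for z m
  proof -
    have "\<bar>2 ^ m * (\<Prod>k<m. (quad c ^^ k) z)\<bar> \<le> 4 ^ m / 2 * \<bar>z\<bar>"
      using that r1 by (intro abs_deriv_quad_funpow_le c) auto
    also have "\<dots> \<le> 4 ^ n / 2 * r"
      using that by (intro mult_mono divide_right_mono power_increasing) auto
    finally show ?thesis by (simp add: r_def)
  qed
  have lip: "\<bar>F y - F z\<bar> \<le> 1 / 4 * \<bar>y - z\<bar>" if "y \<in> {- r..r}" "z \<in> {- r..r}" for y z
  proof -
    have "norm (F y - F z) \<le> 1 / 4 * norm (y - z)"
    proof (rule field_differentiable_bound[where S = "{- r..r}"])
      show "(F has_field_derivative 2 ^ n * (\<Prod>k<n. (quad c ^^ k) w)) (at w within {- r..r})" for w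
        unfolding F_def by (rule has_field_derivative_at_within[OF has_field_derivative_quad_funpow])
      show "norm (2 ^ n * (\<Prod>k<n. (quad c ^^ k) w)) \<le> 1 / 4" if "w \<in> {- r..r}" for w
        using deriv_small[of w n] that n nx unfolding real_norm_def by fastforce
    qed (use that in auto)
    then show ?thesis by simp
  qed
  have zero: "0 \<in> {- r..r}" using x0 by (simp add: r_def)
  have maps: "F z \<in> {- r..r}" if "z \<in> {- r..r}" for z
  proof -
    have "\<bar>z\<bar> \<le> 2 * \<bar>F 0\<bar>" using that by (auto simp: x_def r_def)
    then have "\<bar>F z - F 0\<bar> \<le> \<bar>F 0\<bar>"
      using lip[OF that zero] abs_ge_zero[of "F 0"] unfolding diff_0_right by linarith
    then have "\<bar>F z\<bar> \<le> 2 * \<bar>F 0\<bar>" by linarith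
    then show ?thesis by (auto simp: x_def r_def)
  qed
  have "\<exists>!\<alpha>. \<alpha> \<in> {- r..r} \<and> F \<alpha> = \<alpha>"
    by (rule Banach_fix[where c = "1 / 4"])
      (use zero maps lip in \<open>auto simp: dist_real_def compact_imp_complete\<close>)
  then obtain \<alpha> where \<alpha>: "\<alpha> \<in> {- r..r}" "F \<alpha> = \<alpha>" by blast
  have Fk: "(F ^^ k) 0 \<in> {- r..r} \<and> \<bar>(F ^^ k) 0 - \<alpha>\<bar> \<le> (1 / 4) ^ k * \<bar>\<alpha>\<bar>" for k
  proof (induction k)
    case 0
    show ?case using zero by simp
  next
    case (Suc k)
    then have "\<bar>F ((F ^^ k) 0) - F \<alpha>\<bar> \<le> 1 / 4 * ((1 / 4) ^ k * \<bar>\<alpha>\<bar>)"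
      using lip[of "(F ^^ k) 0" \<alpha>] \<alpha> by fastforce
    then show ?case using Suc maps \<alpha>(2) by simp
  qed
  have "(\<lambda>k. (F ^^ k) 0 - \<alpha>) \<longlonglongrightarrow> 0"
  proof (rule Lim_null_comparison)
    show "\<forall>\<^sub>F k in sequentially. norm ((F ^^ k) 0 - \<alpha>) \<le> (1 / 4) ^ k * \<bar>\<alpha>\<bar>" using Fk by simp
    have "(\<lambda>k. (1 / 4 :: real) ^ k) \<longlonglongrightarrow> 0" by (rule LIMSEQ_realpow_zero) auto
    then show "(\<lambda>k. (1 / 4) ^ k * \<bar>\<alpha>\<bar>) \<longlonglongrightarrow> 0" by (rule tendsto_mult_left_zero)
  qed
  then have "(\<lambda>k. (F ^^ k) 0) \<longlonglongrightarrow> \<alpha>" by (simp add: LIM_zero_iff)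
  then have "(\<lambda>k. complex_of_real ((F ^^ k) 0)) \<longlonglongrightarrow> of_real \<alpha>" by (rule tendsto_of_real)
  moreover have "complex_of_real ((F ^^ k) 0) = (quad (of_real c) ^^ (n * k)) 0" for k
    using funpow_quad_of_real[where c = c and k = "n * k" and z = 0] by (simp add: F_def funpow_mult)
  ultimately have basin_n: "0 \<in> basin (quad (complex_of_real c)) n (of_real \<alpha>)"
    by (simp add: basin_def)
  have per_n: "(quad (complex_of_real c) ^^ n) (of_real \<alpha>) = of_real \<alpha>"
    using \<alpha>(2) by (simp add: funpow_quad_of_real F_def)
  obtain m where m: "has_exact_period (quad (complex_of_real c)) m (of_real \<alpha>)" "m dvd n"
    using has_exact_period_exists_dvd[OF per_n n] by blast
  have m1: "1 \<le> m" "m \<le> n" and per_m: "(quad (complex_of_real c) ^^ m) (of_real \<alpha>) = of_real \<alpha>"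
    using m n by (auto simp: has_exact_period_def dvd_imp_le)
  have "0 \<in> basin (quad (complex_of_real c)) m (of_real \<alpha>)"
  proof -
    have "isCont (quad (complex_of_real c)) z" for z unfolding quad_def[abs_def] by simp
    from basin_period_dvd[OF this per_m m(2) n] basin_n show ?thesis by blast
  qed
  moreover have "cmod (multiplier (quad (of_real c)) m (of_real \<alpha>)) \<le> rho n"
  proof -
    have "multiplier (quad (of_real c)) m (of_real \<alpha>)
            = 2 ^ m * (\<Prod>k<m. (quad (complex_of_real c) ^^ k) (of_real \<alpha>))"
      unfolding multiplier_def by (rule DERIV_imp_deriv[OF has_field_derivative_quad_funpow])
    also have "\<dots> = of_real (2 ^ m * (\<Prod>k<m. (quad c ^^ k) \<alpha>))"
      by (simp add: funpow_quad_of_real)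
    finally have "cmod (multiplier (quad (of_real c)) m (of_real \<alpha>))
            = \<bar>2 ^ m * (\<Prod>k<m. (quad c ^^ k) \<alpha>)\<bar>" by (simp only: norm_of_real)
    also have "\<dots> \<le> 4 ^ n * x" using \<alpha>(1) m1 by (intro deriv_small) auto
    finally show ?thesis using close by (simp add: x_def F_def)
  qed
  ultimately have "complex_of_real c \<in> D_set m (rho m)"
    using m(1) rho_antimono[OF m1(2)] rho4 unfolding D_set_def attracting_def by fastforce
  then show ?thesis using m1(1) by blast
qed

section \<open>Parameters between -2 and 0\<close>

lemma prod_orbit_num_le:
  fixes a b :: int
  assumes b: "b > 0" and a: "- 2 * b \<le> a" "a \<le> 0"
  shows "(\<Prod>k=1..h. \<bar>orbit_num a b k\<bar>) \<le> 2 ^ h * b ^ (2 ^ h - 1)"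
proof (induction h)
  case 0
  show ?case by simp
next
  case (Suc h)
  define c where "c = real_of_int a / real_of_int b"
  have c: "- 2 \<le> c" "c \<le> 0"
    using a b of_int_le_iff[where 'a = real, of "- 2 * b" a] by (auto simp: c_def field_simps)
  have "\<bar>(quad c ^^ Suc h) 0\<bar> \<le> max 1 (- c)" by (rule quad_orbit_bound[OF c]) simp
  then have "\<bar>(quad c ^^ Suc h) 0\<bar> \<le> 2" using c by linarith
  then have "\<bar>real_of_int (orbit_num a b (Suc h))\<bar> \<le> 2 * real_of_int b ^ 2 ^ h"
    using b quad_orbit_eq_orbit_num[where 'a = real and a = a and b = b and n = "Suc h"]
    by (simp add: c_def field_simps del: orbit_num.simps funpow.simps)
  then have "real_of_int \<bar>orbit_num a b (Suc h)\<bar> \<le> real_of_int (2 * b ^ 2 ^ h)" by simp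
  then have le: "\<bar>orbit_num a b (Suc h)\<bar> \<le> 2 * b ^ 2 ^ h" by (simp only: of_int_le_iff)
  have "(\<Prod>k=1..Suc h. \<bar>orbit_num a b k\<bar>) \<le> (2 ^ h * b ^ (2 ^ h - 1)) * (2 * b ^ 2 ^ h)"
    using b mult_mono[OF Suc le] by (simp del: orbit_num.simps)
  also have "\<dots> = 2 ^ Suc h * b ^ ((2 ^ h - 1) + 2 ^ h)" by (simp only: power_add) simp
  also have "(2 ^ h - 1) + 2 ^ h = (2::nat) ^ Suc h - 1" by simp
  finally show ?case .
qed

text \<open>Since \<open>c\<close> is not in any of the excluded sets, 0 has no close return:
  \<open>\<bar>x\<^sub>n\<bar> > rho n / 4 ^ n\<close>. Multiplied by the denominator \<open>b ^ 2 ^ (n - 1)\<close> this bounds the numerator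
  from below, and the hypothesis on \<open>b\<close> is what is needed to beat \<open>prod_orbit_num_le\<close>.\<close>
lemma prod_orbit_num_less_if_mem_S_set:
  fixes a b :: int
  assumes b: "b > 0" and a: "- 2 * b \<le> a" "a \<le> 0" and n: "n \<ge> 3"
    and S: "complex_of_real (of_int a / of_int b) \<in> S_set"
    and large: "(2::int) ^ (n div 2 + 2 * n + 2 ^ (n - 2)) \<le> b ^ (2 ^ (n - 1) - (2 ^ (n div 2) - 1))"
  shows "(\<Prod>k=1..n div 2. \<bar>orbit_num a b k\<bar>) < \<bar>orbit_num a b n\<bar>"
proof -
  define c h N where "c = real_of_int a / real_of_int b" and "h = n div 2"
    and "N = orbit_num a b n"
  have c: "- 2 \<le> c" "c \<le> 0"
    using a b of_int_le_iff[where 'a = real, of "- 2 * b" a] by (auto simp: c_def field_simps)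
  have "\<not> 4 ^ n * \<bar>(quad c ^^ n) 0\<bar> \<le> rho n"
    using close_return_imp_mem_D_set[OF c, of n] S n unfolding S_set_def c_def by auto
  then have "1 / 2 ^ 2 ^ (n - 2) < 4 ^ n * (\<bar>real_of_int N\<bar> / real_of_int b ^ 2 ^ (n - 1))"
    using b quad_orbit_eq_orbit_num[where 'a = real and a = a and b = b and n = n] n
    by (simp add: rho_eq c_def N_def)
  then have "real_of_int b ^ 2 ^ (n - 1) < 4 ^ n * 2 ^ 2 ^ (n - 2) * \<bar>real_of_int N\<bar>"
    using b by (simp add: field_simps)
  then have "real_of_int (b ^ 2 ^ (n - 1)) < real_of_int (4 ^ n * 2 ^ 2 ^ (n - 2) * \<bar>N\<bar>)" by simp
  then have far: "b ^ 2 ^ (n - 1) < 4 ^ n * 2 ^ 2 ^ (n - 2) * \<bar>N\<bar>" by (simp only: of_int_less_iff)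
  have "(2::nat) ^ h \<le> 2 ^ (n - 1)" using n by (intro power_increasing) (auto simp: h_def)
  then have exponent: "2 ^ (n - 1) = (2 ^ (n - 1) - (2 ^ h - 1)) + (2 ^ h - 1 :: nat)" by linarith
  have "(4 ^ n * 2 ^ 2 ^ (n - 2)) * (2 ^ h * b ^ (2 ^ h - 1))
          = 2 ^ (h + 2 * n + 2 ^ (n - 2)) * b ^ (2 ^ h - 1)"
    by (simp add: power_add power_mult)
  also have "\<dots> \<le> b ^ (2 ^ (n - 1) - (2 ^ h - 1)) * b ^ (2 ^ h - 1)"
    using large b by (intro mult_right_mono) (auto simp: h_def)
  also have "\<dots> = b ^ 2 ^ (n - 1)"
    unfolding power_add[symmetric] using exponent by simp
  finally have "(4 ^ n * 2 ^ 2 ^ (n - 2)) * (2 ^ h * b ^ (2 ^ h - 1))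
                  < 4 ^ n * 2 ^ 2 ^ (n - 2) * \<bar>N\<bar>" using far by linarith
  then have "2 ^ h * b ^ (2 ^ h - 1) < \<bar>N\<bar>" by (simp add: mult_less_cancel_left)
  then show ?thesis using prod_orbit_num_le[OF b a, of h] by (simp add: h_def N_def)
qed

text \<open>Taking logarithms to base 2, the exponent on the left is about half of the one on the right
  for large \<open>n\<close>, so \<open>b \<ge> 2\<close> suffices from \<open>n = 7\<close> on. For \<open>n = 4, 5, 6\<close> the inequalities read
  \<open>2 ^ 14 \<le> b ^ 5\<close>, \<open>2 ^ 20 \<le> b ^ 13\<close> and \<open>2 ^ 31 \<le> b ^ 25\<close>.\<close>
lemma denominator_large_enough:
  fixes b :: int
  assumes "n = 4 \<and> b \<ge> 7 \<or> (n = 5 \<or> n = 6) \<and> b \<ge> 3 \<or> n \<ge> 7 \<and> b \<ge> 2"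
  shows "(2::int) ^ (n div 2 + 2 * n + 2 ^ (n - 2)) \<le> b ^ (2 ^ (n - 1) - (2 ^ (n div 2) - 1))"
proof -
  consider "n = 4" "b \<ge> 7" | "n = 5" "b \<ge> 3" | "n = 6" "b \<ge> 3" | "n \<ge> 7" "b \<ge> 2" using assms by blast
  then show ?thesis
  proof cases
    case 1
    then show ?thesis using power_mono[of 7 b 5] by simp
  next
    case 2
    then show ?thesis using power_mono[of 3 b 13] by simp
  next
    case 3
    then show ?thesis using power_mono[of 3 b 25] by simp
  next
    case 4
    \<comment> \<open>All terms are compared with \<open>2 ^ (n - 4)\<close>: those with \<open>n\<close> use at most 3 of them, the two
      powers of 2 use 5, and the exponent on the right provides 8.\<close>
    have "n \<le> 2 ^ (n - 4)" using \<open>n \<ge> 7\<close>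
    proof (induction n rule: nat_induct_at_least)
      case (Suc n)
      have "(2::nat) ^ (Suc n - 4) = 2 * 2 ^ (n - 4)"
        using Suc.hyps by (simp flip: power_Suc add: Suc_diff_le)
      then show ?case using Suc by linarith
    qed simp
    moreover have "(2::nat) ^ (n div 2) \<le> 2 ^ (n - 4)"
      using 4 by (intro power_increasing) auto
    moreover have "n div 2 + 4 \<le> n" using 4 by linarith
    moreover have "(2::nat) ^ (n - 2) = 4 * 2 ^ (n - 4)" "(2::nat) ^ (n - 1) = 8 * 2 ^ (n - 4)"
    proof -
      have "n = (n - 4) + 4" using 4 by simp
      then obtain d where "n = d + 4" by blast
      then show "(2::nat) ^ (n - 2) = 4 * 2 ^ (n - 4)" "(2::nat) ^ (n - 1) = 8 * 2 ^ (n - 4)"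
        by (simp_all add: power_add)
    qed
    ultimately have "n div 2 + 2 * n + 2 ^ (n - 2) \<le> 2 ^ (n - 1) - (2 ^ (n div 2) - 1 :: nat)"
      by linarith
    then have "(2::int) ^ (n div 2 + 2 * n + 2 ^ (n - 2)) \<le> 2 ^ (2 ^ (n - 1) - (2 ^ (n div 2) - 1))"
      by (rule power_increasing) simp
    also have "\<dots> \<le> b ^ (2 ^ (n - 1) - (2 ^ (n div 2) - 1))" using 4 by (intro power_mono) auto
    finally show ?thesis .
  qed
qed

lemma orbit_num_numeral:
  "orbit_num a b (numeral v)
      = (orbit_num a b (pred_numeral v))\<^sup>2 + a * b ^ (2 ^ pred_numeral v - 1)"
  by (simp add: numeral_eq_Suc)

text \<open>The pairs \<open>(n, b)\<close> that the general estimate misses leave finitely many \<open>a\<close>. The value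
  \<open>a = - b\<close> has to be left out because 0 is then periodic of period 2 and both sides vanish for
  even \<open>n\<close>.\<close>
lemma prod_orbit_num_less_small_denominator:
  fixes a b :: int
  assumes "- 2 * b < a" "a < 0" "a \<noteq> - b"
    and "n = 4 \<and> b \<in> {2..6} \<or> (n = 5 \<or> n = 6) \<and> b = 2"
  shows "(\<Prod>k=1..n div 2. \<bar>orbit_num a b k\<bar>) < \<bar>orbit_num a b n\<bar>"
proof -
  have "b \<in> {2, 3, 4, 5, 6}" using assms(4) by auto
  moreover have "- 11 \<le> a" "a \<le> - 1" using assms by auto
  then have "a \<in> {-11, -10, -9, -8, -7, -6, -5, -4, -3, -2, -1}"
    unfolding insert_iff empty_iff by presburger
  ultimately have "(n, b, a) \<in> {(4, 2, -3), (4, 2, -1), (4, 3, -5), (4, 3, -4), (4, 3, -2), (4, 3, -1),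
      (4, 4, -7), (4, 4, -6), (4, 4, -5), (4, 4, -3), (4, 4, -2), (4, 4, -1), (4, 5, -9), (4, 5, -8),
      (4, 5, -7), (4, 5, -6), (4, 5, -4), (4, 5, -3), (4, 5, -2), (4, 5, -1), (4, 6, -11), (4, 6, -10),
      (4, 6, -9), (4, 6, -8), (4, 6, -7), (4, 6, -5), (4, 6, -4), (4, 6, -3), (4, 6, -2), (4, 6, -1),
      (5, 2, -3), (5, 2, -1), (6, 2, -3), (6, 2, -1)}"
    using assms by (elim insertE emptyE) simp_all
  moreover have "{1..2} = {1, 2 :: nat}" "{1..3} = {1, 2, 3 :: nat}" by auto
  ultimately show ?thesis
    by (elim insertE emptyE) (simp_all add: orbit_num_numeral)
qed

lemma prod_orbit_num_less_if_bounded: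
  fixes a b :: int
  assumes b: "b \<ge> 2" and a: "- 2 * b < a" "a < 0" "a \<noteq> - b" and n: "n \<ge> 4"
    and S: "complex_of_real (of_int a / of_int b) \<in> S_set"
  shows "(\<Prod>k=1..n div 2. \<bar>orbit_num a b k\<bar>) < \<bar>orbit_num a b n\<bar>"
proof (cases "n = 4 \<and> b \<in> {2..6} \<or> (n = 5 \<or> n = 6) \<and> b = 2")
  case True
  then show ?thesis using prod_orbit_num_less_small_denominator a by blast
next
  case False
  then have "n = 4 \<and> b \<ge> 7 \<or> (n = 5 \<or> n = 6) \<and> b \<ge> 3 \<or> n \<ge> 7 \<and> b \<ge> 2"
    using n b by auto
  from denominator_large_enough[OF this] show ?thesis
    using prod_orbit_num_less_if_mem_S_set[of b a n] b a n S by simp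
qed

section \<open>Primitive divisors from the fourth iterate on\<close>

lemma finite_orbit_if_periodic:
  assumes "n \<ge> 1" "(f ^^ n) x = x"
  shows "finite {(f ^^ k) x | k. k \<ge> 1}"
proof (rule finite_subset)
  show "{(f ^^ k) x | k. k \<ge> 1} \<subseteq> (\<lambda>k. (f ^^ k) x) ` {..<n}"
    using assms by (force simp: funpow_mod_eq intro!: image_eqI[where x = "k mod n" for k])
qed simp

theorem theorem1p4:
  fixes a b :: int and c :: rat
  assumes "b > 0" and "coprime a b" and "c = of_int a / of_int b"
    and "of_rat c \<in> S_set"
    and "infinite {(quad c ^^ n) 0 | n. n \<ge> 1}"
  shows "\<forall>n>3. n \<notin> zsigmondy_set c"
proof (intro allI impI notI)
  fix n :: nat
  assume n: "n > 3" and Z: "n \<in> zsigmondy_set c"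
  have nz: "orbit_num a b k \<noteq> 0" if "k \<ge> 1" for k
  proof
    assume 0: "orbit_num a b k = 0"
    have "(quad c ^^ k) 0 = of_int (orbit_num a b k) / of_int b ^ 2 ^ (k - 1)"
      unfolding assms(3) using assms(1) by (intro quad_orbit_eq_orbit_num) simp
    then have "(quad c ^^ k) 0 = 0" unfolding 0 by simp
    from finite_orbit_if_periodic[OF that this] assms(5) show False by contradiction
  qed
  have crit: "crit_num c k = orbit_num a b k" if "k \<ge> 1" for k
    using crit_num_eq_orbit_num that assms by blast
  have "orbit_num a b n dvd (\<Prod>k=1..n div 2. orbit_num a b k)"
  proof (rule orbit_num_dvd_prod_if_no_primitive_divisor[OF assms(2) _ nz])
    fix p :: int assume "prime p" "p dvd orbit_num a b n"
    then obtain k where "1 \<le> k" "k < n" "p dvd crit_num c k"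
      using Z n crit unfolding zsigmondy_set_def by auto
    then show "\<exists>k\<ge>1. k < n \<and> p dvd orbit_num a b k" using crit by auto
  qed (use n in auto)
  moreover have "(\<Prod>k=1..n div 2. orbit_num a b k) \<noteq> 0" using nz by simp
  ultimately have "\<bar>orbit_num a b n\<bar> \<le> \<bar>\<Prod>k=1..n div 2. orbit_num a b k\<bar>"
    by (intro dvd_imp_le_int)
  then have le: "\<bar>orbit_num a b n\<bar> \<le> (\<Prod>k=1..n div 2. \<bar>orbit_num a b k\<bar>)"
    by (simp only: abs_prod)
  \<comment> \<open>The integers 0, -1 and -2 are the only parameters in \<open>[-2, 0]\<close> with denominator 1, and their
    critical orbits are finite; every other parameter there has \<open>b \<ge> 2\<close>.\<close>
  have "a \<noteq> 0" using nz[of 1] by auto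
  have "a \<noteq> - b" using nz[of 2] by (auto simp: numeral_2_eq_2 power2_eq_square)
  have "a \<noteq> - 2 * b"
  proof
    assume a: "a = - 2 * b"
    then have c: "c = - 2" using assms(1,3) by simp
    have "(quad c ^^ k) 0 \<in> {0, - 2, 2}" for k
      by (induction k) (auto simp: c quad_def)
    then have "{(quad c ^^ n) 0 | n. n \<ge> 1} \<subseteq> {0, - 2, 2}" by blast
    then show False using assms(5) finite_subset by blast
  qed
  have S: "complex_of_real (of_int a / of_int b) \<in> S_set"
    using assms(3,4) by (simp add: of_rat_divide)
  consider "a > 0" | "a < - 2 * b" | "- 2 * b < a" "a < 0" "b \<ge> 2"
    using \<open>a \<noteq> 0\<close> \<open>a \<noteq> - b\<close> \<open>a \<noteq> - 2 * b\<close> \<open>b > 0\<close> by linarith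
  then have "(\<Prod>k=1..n div 2. \<bar>orbit_num a b k\<bar>) < \<bar>orbit_num a b n\<bar>"
  proof cases
    case 1
    then show ?thesis using prod_orbit_num_less_if_pos assms(1) n by simp
  next
    case 2
    then show ?thesis using prod_orbit_num_less_if_less_minus_2 assms(1) n by simp
  next
    case 3
    then show ?thesis using prod_orbit_num_less_if_bounded \<open>a \<noteq> - b\<close> n S by simp
  qed
  with le show False by linarith
qed

end
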